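(* Let $\langle\mathbb{V}(X),\mathbb{V}(X),\ast\rangle$ be a single superstructure model of nonstandard methods and let $Y$ be a set in $\mathbb{V}(X)$. The following are equivalent: (1) $Y$ is completely coherent; (2) for every $y\in Y$ we have $y={}^{\ast}y$.
   Context: A single superstructure model of nonstandard methods consists of an infinite set $X$, its superstructure $\mathbb{V}(X)$, and a star map $\ast:\mathbb{V}(X)\to\mathbb{V}(X)$ satisfying the transfer principle. A set $Y\in\mathbb{V}(X)$ is called coherent if $Y\subseteq{}^{\ast}Y$, and completely coherent if every subset $A\subseteq Y$ is coherent. *)

theory Defs
  imports Main
begin

text \<open>
  HOL has no type that contains X, the power set of X, its power set, and so on at once, and
  for infinite X such a type cannot be constructed in HOL. A superstructure is therefore given
  by an ambient type \<open>'v\<close> of atoms and sets with a membership relation \<open>mem\<close>; the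
  predicate \<open>is_superstructure\<close> below determines the cumulative hierarchy over \<open>X\<close>, with
  \<^emph>\<open>full\<close> power sets at every stage, up to isomorphism.
\<close>

definition elts :: "('v \<Rightarrow> 'v \<Rightarrow> bool) \<Rightarrow> 'v \<Rightarrow> 'v set" where
  "elts mem v = {u. mem u v}"

primrec level :: "('v \<Rightarrow> 'v \<Rightarrow> bool) \<Rightarrow> 'v set \<Rightarrow> nat \<Rightarrow> 'v set" where
  "level mem X 0 = X"
| "level mem X (Suc n) = level mem X n \<union> {v. v \<notin> X \<and> elts mem v \<subseteq> level mem X n}"

definition superstructure :: "('v \<Rightarrow> 'v \<Rightarrow> bool) \<Rightarrow> 'v set \<Rightarrow> 'v set" where
  "superstructure mem X = (\<Union>n. level mem X n)"

text \<open>
  The members of \<open>X\<close> are atoms; the members of \<open>superstructure mem X - X\<close> are the sets.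
  The third clause says that every subcollection of a stage is (the extension of) a set.
\<close>

definition is_superstructure :: "('v \<Rightarrow> 'v \<Rightarrow> bool) \<Rightarrow> 'v set \<Rightarrow> bool" where
  "is_superstructure mem X \<longleftrightarrow>
     (\<forall>x\<in>X. elts mem x = {}) \<and>
     (\<forall>u \<in> superstructure mem X - X. \<forall>v \<in> superstructure mem X - X.
        elts mem u = elts mem v \<longrightarrow> u = v) \<and>
     (\<forall>n A. A \<subseteq> level mem X n \<longrightarrow> (\<exists>v. v \<notin> X \<and> elts mem v = A))"

datatype bfm =
    Eq nat nat
  | Mem nat nat
  | Neg bfm
  | Conj bfm bfm
  | Disj bfm bfm
  | Imp bfm bfm
  | Iff bfm bfm
  | BAll nat nat bfm
  | BEx nat nat bfm

text \<open>
  Formulas with bounded quantifiers: \<open>BAll i j \<phi>\<close> is the formula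
  \<open>\<forall>x\<^sub>i. x\<^sub>i \<in> x\<^sub>j \<longrightarrow> \<phi>\<close>, and \<open>BEx i j \<phi>\<close> is \<open>\<exists>x\<^sub>i. x\<^sub>i \<in> x\<^sub>j \<and> \<phi>\<close>.
  \<open>sat mem V e \<phi>\<close> is truth of \<open>\<phi>\<close> in the structure with universe \<open>V\<close> under the valuation \<open>e\<close>.
\<close>

primrec sat :: "('v \<Rightarrow> 'v \<Rightarrow> bool) \<Rightarrow> 'v set \<Rightarrow> (nat \<Rightarrow> 'v) \<Rightarrow> bfm \<Rightarrow> bool" where
  "sat mem V e (Eq i j) \<longleftrightarrow> e i = e j"
| "sat mem V e (Mem i j) \<longleftrightarrow> mem (e i) (e j)"
| "sat mem V e (Neg \<phi>) \<longleftrightarrow> \<not> sat mem V e \<phi>"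
| "sat mem V e (Conj \<phi> \<psi>) \<longleftrightarrow> sat mem V e \<phi> \<and> sat mem V e \<psi>"
| "sat mem V e (Disj \<phi> \<psi>) \<longleftrightarrow> sat mem V e \<phi> \<or> sat mem V e \<psi>"
| "sat mem V e (Imp \<phi> \<psi>) \<longleftrightarrow> (sat mem V e \<phi> \<longrightarrow> sat mem V e \<psi>)"
| "sat mem V e (Iff \<phi> \<psi>) \<longleftrightarrow> (sat mem V e \<phi> \<longleftrightarrow> sat mem V e \<psi>)"
| "sat mem V e (BAll i j \<phi>) \<longleftrightarrow>
     (\<forall>a\<in>V. mem ((e(i := a)) i) ((e(i := a)) j) \<longrightarrow> sat mem V (e(i := a)) \<phi>)"
| "sat mem V e (BEx i j \<phi>) \<longleftrightarrow>
     (\<exists>a\<in>V. mem ((e(i := a)) i) ((e(i := a)) j) \<and> sat mem V (e(i := a)) \<phi>)"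

definition transfer_principle ::
    "('v \<Rightarrow> 'v \<Rightarrow> bool) \<Rightarrow> 'v set \<Rightarrow> ('v \<Rightarrow> 'v) \<Rightarrow> bool" where
  "transfer_principle mem V star \<longleftrightarrow>
     (\<forall>\<phi> e. (\<forall>i. e i \<in> V) \<longrightarrow> (sat mem V e \<phi> \<longleftrightarrow> sat mem V (\<lambda>i. star (e i)) \<phi>))"

definition single_superstructure_model ::
    "('v \<Rightarrow> 'v \<Rightarrow> bool) \<Rightarrow> 'v set \<Rightarrow> ('v \<Rightarrow> 'v) \<Rightarrow> bool" where
  "single_superstructure_model mem X star \<longleftrightarrow>
     infinite X \<and> is_superstructure mem X \<and>
     (\<forall>v \<in> superstructure mem X. star v \<in> superstructure mem X) \<and>
     transfer_principle mem (superstructure mem X) star"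

definition coherent :: "('v \<Rightarrow> 'v \<Rightarrow> bool) \<Rightarrow> ('v \<Rightarrow> 'v) \<Rightarrow> 'v \<Rightarrow> bool" where
  "coherent mem star Y \<longleftrightarrow> elts mem Y \<subseteq> elts mem (star Y)"

definition completely_coherent ::
    "('v \<Rightarrow> 'v \<Rightarrow> bool) \<Rightarrow> 'v set \<Rightarrow> ('v \<Rightarrow> 'v) \<Rightarrow> 'v \<Rightarrow> bool" where
  "completely_coherent mem X star Y \<longleftrightarrow>
     (\<forall>A \<in> superstructure mem X - X. elts mem A \<subseteq> elts mem Y \<longrightarrow> coherent mem star A)"

end

theory Submission
  imports Defs
begin

text \<open>
  Transfer gives \<open>star {y} = {star y}\<close>, so coherence of the subset \<open>{y}\<close> of \<open>Y\<close> already forces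
  \<open>y = star y\<close>. Conversely, \<open>y \<in> A\<close> transfers to \<open>star y \<in> star A\<close>, which is \<open>y \<in> star A\<close>
  when \<open>y\<close> is fixed.
\<close>

text \<open>Stage 0 holds only atoms, so a set first enters at some successor stage, and the
  defining condition there bounds its elements by the stage before.\<close>

lemma superstructure_set_elts_subset_level:
  assumes "v \<in> superstructure mem X - X"
  obtains n where "elts mem v \<subseteq> level mem X n"
proof -
  have "\<exists>n. elts mem v \<subseteq> level mem X n" if "v \<in> level mem X k" "v \<notin> X" for k
    using that by (induction k) auto
  then show thesis
    using assms that unfolding superstructure_def by blast
qed

lemma superstructure_subset_set:
  assumes "is_superstructure mem X" and "A \<subseteq> level mem X n"
  obtains v where "v \<in> superstructure mem X - X" and "elts mem v = A"
proof -
  obtain v where v: "v \<notin> X" "elts mem v = A"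
    using assms unfolding is_superstructure_def by blast
  \<comment> \<open>Fullness only yields \<open>v\<close> in the ambient type; one stage above
    \<open>A\<close> it joins the hierarchy.\<close>
  then have "v \<in> level mem X (Suc n)"
    using assms(2) by simp
  then show thesis
    using v that unfolding superstructure_def by blast
qed

lemma transfer_mem_iff:
  assumes "transfer_principle mem V star" and "a \<in> V" and "b \<in> V"
  shows "mem (star a) (star b) \<longleftrightarrow> mem a b"
proof -
  \<comment> \<open>Valuations are total, so all indices beyond the two in use default to
    \<open>b\<close>, keeping \<open>e\<close> inside \<open>V\<close>.\<close>
  define e where "e = (\<lambda>i::nat. if i = 0 then a else b)"
  have "\<forall>i. e i \<in> V"
    using assms(2,3) by (simp add: e_def)
  then have "sat mem V e (Mem 0 1) \<longleftrightarrow> sat mem V (\<lambda>i. star (e i)) (Mem 0 1)"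
    using assms(1) unfolding transfer_principle_def by blast
  then show ?thesis
    by (simp add: e_def)
qed

text \<open>Transfers the bounded sentence "every element of \<open>s\<close> equals
  \<open>y\<close>", with \<open>s\<close> and \<open>y\<close> as parameters.\<close>

lemma mem_star_singletonD:
  assumes "transfer_principle mem V star" and "s \<in> V" and "y \<in> V"
    and "elts mem s = {y}" and "z \<in> V" and "mem z (star s)"
  shows "z = star y"
proof -
  define e where "e = (\<lambda>i::nat. if i = 0 then s else y)"
  \<comment> \<open>Index 2 is fresh, so binding it leaves the parameters at 0 and 1
    untouched.\<close>
  have "sat mem V e (BAll 2 0 (Eq 2 1))"
    using assms(4) by (auto simp: e_def elts_def)
  moreover have "\<forall>i. e i \<in> V"
    using assms(2,3) by (simp add: e_def)
  ultimately have "sat mem V (\<lambda>i. star (e i)) (BAll 2 0 (Eq 2 1))"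
    using assms(1) unfolding transfer_principle_def by blast
  then show ?thesis
    using assms(5,6) by (simp add: e_def)
qed

theorem theorem3p6:
  fixes mem :: "'v \<Rightarrow> 'v \<Rightarrow> bool" and X :: "'v set" and star :: "'v \<Rightarrow> 'v" and Y :: 'v
  assumes "single_superstructure_model mem X star"
    and "Y \<in> superstructure mem X - X"
  shows "completely_coherent mem X star Y \<longleftrightarrow> (\<forall>y \<in> elts mem Y. y = star y)"
proof -
  let ?V = "superstructure mem X"
  have sup: "is_superstructure mem X" and tr: "transfer_principle mem ?V star"
    using assms(1) unfolding single_superstructure_model_def by auto
  obtain n where n: "elts mem Y \<subseteq> level mem X n"
    using superstructure_set_elts_subset_level[OF assms(2)] .
  then have YV: "elts mem Y \<subseteq> ?V"
    unfolding superstructure_def by blast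
  show ?thesis
  proof (intro iffI ballI)
    fix y
    assume cc: "completely_coherent mem X star Y" and y: "y \<in> elts mem Y"
    obtain s where s: "s \<in> ?V - X" "elts mem s = {y}"
      using superstructure_subset_set[OF sup, of "{y}" n] n y by blast
    then have "coherent mem star s"
      using cc y unfolding completely_coherent_def by simp
    then have "mem y (star s)"
      using s(2) by (simp add: coherent_def elts_def)
    \<comment> \<open>The lemma is used with \<open>y\<close> itself as the element \<open>z\<close>
      of \<open>star s\<close>.\<close>
    then show "y = star y"
      using mem_star_singletonD[OF tr _ _ s(2)] s(1) y YV by blast
  next
    assume fixed: "\<forall>y \<in> elts mem Y. y = star y"
    show "completely_coherent mem X star Y"
      unfolding completely_coherent_def coherent_def
    proof (intro ballI impI subsetI)
      fix A a
      assume A: "A \<in> ?V - X" "elts mem A \<subseteq> elts mem Y" and a: "a \<in> elts mem A"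
      then have "mem (star a) (star A)"
        using transfer_mem_iff[OF tr, of a A] YV by (auto simp: elts_def)
      moreover have "star a = a"
        using fixed A(2) a by auto
      ultimately show "a \<in> elts mem (star A)"
        by (simp add: elts_def)
    qed
  qed
qed

end
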